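(* Let $\mathcal{A}\subset\mathbb{C}^4$ be an essential central arrangement of $k\ge 4$ hyperplanes such that it has only double intersection lines, i.e. $t_2(1)=\binom{k}{2}$ and $t_r(1)=0$ for all $r>2$. If $\mathcal{A}$ is free, then $k=4$.
   Context: Everything is over $\mathbb{C}$. A central hyperplane arrangement in $\mathbb{C}^n$ is a finite set of distinct linear hyperplanes; it is identified with an arrangement of hyperplanes in $\mathbb{P}^{n-1}$. It is essential if the normals of its hyperplanes span an $n$-dimensional space. For an arrangement in $\mathbb{C}^4$, viewed in $\mathbb{P}^3$, $t_r(1)$ denotes the number of $r$-fold lines, i.e. lines in $\mathbb{P}^3$ (two-dimensional linear subspaces of $\mathbb{C}^4$) that are contained in exactly $r$ of the hyperplanes, $r\ge 2$. Let $S=\mathbb{C}[x_1,\ldots,x_n]$ and ${\rm Der}(S)=\bigoplus_{i=1}^n S\cdot\partial_{x_i}$, where $\sum_i a_i\partial_{x_i}$ is homogeneous of degree $d$ if all $a_i$ are homogeneous polynomials of degree $d$. For each $H\in\mathcal{A}$ fix a linear form $\alpha_H$ with $\ker(\alpha_H)=H$. The derivation module of $\mathcal{A}$ is $$D(\mathcal{A})=\{\theta\in{\rm Der}(S): \theta(\alpha_H)\in S\cdot\alpha_H \text{ for all } H\in\mathcal{A}\}.$$ The arrangement $\mathcal{A}$ is free if $D(\mathcal{A})$ is a free $S$-module, i.e. if there is a homogeneous $S$-basis $\theta_1,\ldots,\theta_n$ of $D(\mathcal{A})$. *)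

theory Defs
  imports "HOL-Analysis.Analysis" "HOL-Library.Poly_Mapping"
begin

section \<open>Central hyperplane arrangements\<close>

text \<open>
  The ambient space is \<open>complex ^ 'n\<close>; \<open>vec.subspace\<close>, \<open>vec.span\<close> and \<open>vec.dim\<close> are the
  complex-linear notions (the unqualified \<open>subspace\<close>, \<open>span\<close>, \<open>dim\<close> are real-linear).
\<close>

definition linear_hyperplane :: "(complex ^ 'n) set \<Rightarrow> bool" where
  "linear_hyperplane H \<longleftrightarrow> vec.subspace H \<and> vec.dim H + 1 = CARD('n)"

definition central_arrangement :: "(complex ^ 'n) set set \<Rightarrow> bool" where
  "central_arrangement A \<longleftrightarrow> finite A \<and> (\<forall>H\<in>A. linear_hyperplane H)"

text \<open>All normals of a hyperplane; they are nonzero multiples of each other. The pairing is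
  bilinear, without complex conjugation.\<close>
definition normals :: "(complex ^ 'n) set \<Rightarrow> (complex ^ 'n) set" where
  "normals H = {a. a \<noteq> 0 \<and> H = {x. (\<Sum>i\<in>UNIV. a $ i * x $ i) = 0}}"

definition essential :: "(complex ^ 'n) set set \<Rightarrow> bool" where
  "essential A \<longleftrightarrow> vec.dim (vec.span (\<Union>H\<in>A. normals H)) = CARD('n)"

text \<open>
  The number \<open>t\<^sub>r(1)\<close> of \<open>r\<close>-fold projective lines, for \<open>r \<ge> 2\<close>. For a central arrangement and
  such \<open>r\<close>, in \<open>complex ^ 4\<close>, every \<open>r\<close>-fold line is the intersection of two members of \<open>A\<close>, so
  the set counted is finite and \<open>card\<close> is the actual number of its elements.
\<close>
definition num_fold_lines :: "(complex ^ 'n) set set \<Rightarrow> nat \<Rightarrow> nat" where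
  "num_fold_lines A r =
     card {L. vec.subspace L \<and> vec.dim L = 2 \<and> card {H\<in>A. L \<subseteq> H} = r}"


section \<open>Polynomials in the coordinates\<close>

text \<open>A polynomial maps exponent vectors, with finite support, to coefficients; the
  multiplication of \<open>Poly_Mapping\<close> is the convolution product.\<close>
type_synonym 'n cpoly = "('n \<Rightarrow>\<^sub>0 nat) \<Rightarrow>\<^sub>0 complex"

definition poly_eval :: "('n::finite) cpoly \<Rightarrow> complex ^ 'n \<Rightarrow> complex" where
  "poly_eval p x =
     (\<Sum>m\<in>Poly_Mapping.keys p. Poly_Mapping.lookup p m * (\<Prod>i\<in>UNIV. x $ i ^ Poly_Mapping.lookup m i))"

text \<open>The zero polynomial is homogeneous of every degree.\<close>
definition homogeneous_poly :: "nat \<Rightarrow> ('n::finite) cpoly \<Rightarrow> bool" where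
  "homogeneous_poly d p \<longleftrightarrow>
     (\<forall>m\<in>Poly_Mapping.keys p. (\<Sum>i\<in>UNIV. Poly_Mapping.lookup m i) = d)"

text \<open>The formal partial derivative. Truncated subtraction of exponents is harmless, since the
  term vanishes if the exponent of the variable \<open>i\<close> is zero.\<close>
definition partial_deriv :: "'n \<Rightarrow> ('n::finite) cpoly \<Rightarrow> 'n cpoly" where
  "partial_deriv i p =
     (\<Sum>m\<in>Poly_Mapping.keys p.
        Poly_Mapping.single (m - Poly_Mapping.single i 1)
          (of_nat (Poly_Mapping.lookup m i) * Poly_Mapping.lookup p m))"


section \<open>Derivations and free arrangements\<close>

text \<open>The vector \<open>\<theta>\<close> of polynomials stands for the derivation with coefficient \<open>\<theta> $ i\<close> at
  the partial derivative in direction \<open>i\<close>.\<close>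
type_synonym 'n derivation = "('n cpoly) ^ 'n"

definition apply_deriv :: "('n::finite) derivation \<Rightarrow> 'n cpoly \<Rightarrow> 'n cpoly" where
  "apply_deriv \<theta> p = (\<Sum>i\<in>UNIV. \<theta> $ i * partial_deriv i p)"

definition homogeneous_deriv :: "nat \<Rightarrow> ('n::finite) derivation \<Rightarrow> bool" where
  "homogeneous_deriv d \<theta> \<longleftrightarrow> (\<forall>i. homogeneous_poly d (\<theta> $ i))"

global_interpretation der: module "(*s) :: ('n::finite) cpoly \<Rightarrow> 'n derivation \<Rightarrow> 'n derivation"
  by unfold_locales (simp_all add: vec_eq_iff algebra_simps)

text \<open>A choice of a linear form \<open>\<alpha> H\<close> with kernel \<open>H\<close> for every \<open>H\<close> in \<open>A\<close>.\<close>
definition defining_forms ::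
  "(complex ^ 'n) set set \<Rightarrow> ((complex ^ 'n) set \<Rightarrow> ('n::finite) cpoly) \<Rightarrow> bool" where
  "defining_forms A \<alpha> \<longleftrightarrow>
     (\<forall>H\<in>A. homogeneous_poly 1 (\<alpha> H) \<and> {x. poly_eval (\<alpha> H) x = 0} = H)"

definition derivation_module ::
  "(complex ^ 'n) set set \<Rightarrow> ((complex ^ 'n) set \<Rightarrow> ('n::finite) cpoly) \<Rightarrow> 'n derivation set" where
  "derivation_module A \<alpha> = {\<theta>. \<forall>H\<in>A. \<alpha> H dvd apply_deriv \<theta> (\<alpha> H)}"

text \<open>Existence of a homogeneous basis with as many elements as there are coordinates; the
  degrees of the basis elements may differ.\<close>
definition free_arrangement ::
  "(complex ^ 'n) set set \<Rightarrow> ((complex ^ 'n) set \<Rightarrow> ('n::finite) cpoly) \<Rightarrow> bool" where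
  "free_arrangement A \<alpha> \<longleftrightarrow>
     (\<exists>B. finite B \<and> card B = CARD('n) \<and> (\<forall>\<theta>\<in>B. \<exists>d. homogeneous_deriv d \<theta>) \<and>
          der.independent B \<and> der.span B = derivation_module A \<alpha>)"

end

theory Submission
  imports Defs
begin

text \<open>
  Let \<open>\<phi>\<close> be a coordinate functional of \<open>D(A)\<close> with respect to a homogeneous basis, \<open>Q\<close> the product
  of the forms \<open>\<alpha>\<^sub>H\<close> and \<open>\<eta>\<^sub>i = \<phi>(Q \<partial>\<^sub>i)\<close>, so that \<open>\<phi>\<close> is the logarithmic form
  \<open>\<Sum>\<^sub>i (\<eta>\<^sub>i/Q) dx\<^sub>i\<close>. On \<open>H\<close> the vector \<open>\<eta>\<close> is a multiple of the normal of \<open>H\<close>, as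
  \<open>(Q/\<alpha>\<^sub>H) \<partial>\<^sub>v\<close> lies in \<open>D(A)\<close> for \<open>v \<in> H\<close>; hence \<open>\<eta>\<close> vanishes on \<open>H \<inter> K\<close> for \<open>H \<noteq> K\<close>. Because all
  intersection lines are double, it follows that \<open>\<eta> = f\<^sub>H (Q/\<alpha>\<^sub>H) \<cdot> d\<alpha>\<^sub>H\<close> on \<open>H\<close> with a polynomial \<open>f\<^sub>H\<close>, and
  therefore \<open>\<phi> = \<Sum>\<^sub>H f\<^sub>H d\<alpha>\<^sub>H/\<alpha>\<^sub>H + \<Sum>\<^sub>i \<zeta>\<^sub>i dx\<^sub>i\<close> with polynomials \<open>\<zeta>\<^sub>i\<close>. Evaluating \<open>\<phi>(\<theta>) = 1\<close> at the
  origin, for \<open>\<theta>\<close> the basis element dual to \<open>\<phi>\<close>, shows that \<open>\<theta>\<close> has degree at most 1. Then every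
  \<open>\<theta>(\<alpha>\<^sub>H)/\<alpha>\<^sub>H\<close> is a constant. The forms \<open>d\<alpha>\<^sub>H/\<alpha>\<^sub>H\<close> are linearly independent over the complex numbers
  and determined by these constants on the four basis elements, so there are at most four of them.
\<close>

section \<open>Evaluation of polynomials\<close>

definition monom_eval :: "('n::finite \<Rightarrow>\<^sub>0 nat) \<Rightarrow> complex ^ 'n \<Rightarrow> complex" where
  "monom_eval m x = (\<Prod>i\<in>UNIV. x $ i ^ Poly_Mapping.lookup m i)"

lemma monom_eval_zero: "monom_eval 0 x = 1"
  by (simp add: monom_eval_def)

lemma monom_eval_add: "monom_eval (m + m') x = monom_eval m x * monom_eval m' x"
  by (simp add: monom_eval_def lookup_add power_add prod.distrib)

lemma monom_eval_single: "monom_eval (Poly_Mapping.single i 1) x = x $ i"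
proof -
  have "monom_eval (Poly_Mapping.single i 1) x = (\<Prod>j\<in>UNIV. if j = i then x $ i else 1)"
    unfolding monom_eval_def by (rule prod.cong) (auto simp: lookup_single)
  then show ?thesis by simp
qed

lemma poly_eval_superset:
  assumes "finite M" "Poly_Mapping.keys p \<subseteq> M"
  shows "poly_eval p x = (\<Sum>m\<in>M. Poly_Mapping.lookup p m * monom_eval m x)"
  unfolding poly_eval_def monom_eval_def using assms
  by (intro sum.mono_neutral_left) (auto simp: in_keys_iff)

lemma poly_eval_single: "poly_eval (Poly_Mapping.single m c) x = c * monom_eval m x"
  by (subst poly_eval_superset[where M = "{m}"]) auto

lemma poly_eval_zero [simp]: "poly_eval 0 x = 0"
  by (simp add: poly_eval_def)

lemma poly_eval_one [simp]: "poly_eval 1 x = 1"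
  using poly_eval_single[of 0 1 x] by (simp add: monom_eval_zero)

lemma poly_eval_const [simp]: "poly_eval (Poly_Mapping.single 0 c) x = c"
  by (simp add: poly_eval_single monom_eval_zero)

lemma poly_eval_add [simp]: "poly_eval (p + q) x = poly_eval p x + poly_eval q x"
proof -
  let ?M = "Poly_Mapping.keys p \<union> Poly_Mapping.keys q"
  have "Poly_Mapping.keys (p + q) \<subseteq> ?M" by (rule keys_add)
  then show ?thesis
    by (simp add: poly_eval_superset[where M = ?M] lookup_add distrib_right sum.distrib)
qed

lemma poly_eval_sum [simp]: "poly_eval (sum f I) x = (\<Sum>i\<in>I. poly_eval (f i) x)"
  by (induction I rule: infinite_finite_induct) auto

lemma poly_mapping_sum_single:
  "p = (\<Sum>m\<in>Poly_Mapping.keys p. Poly_Mapping.single m (Poly_Mapping.lookup p m))"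
proof (rule poly_mapping_eqI)
  fix k
  have "(\<Sum>m\<in>Poly_Mapping.keys p. (Poly_Mapping.lookup p m when m = k))
      = (\<Sum>m\<in>Poly_Mapping.keys p. if m = k then Poly_Mapping.lookup p k else 0)"
    by (rule sum.cong) auto
  also have "\<dots> = Poly_Mapping.lookup p k"
    by (auto simp: in_keys_iff)
  finally show "Poly_Mapping.lookup p k =
      Poly_Mapping.lookup (\<Sum>m\<in>Poly_Mapping.keys p. Poly_Mapping.single m (Poly_Mapping.lookup p m)) k"
    by (simp add: lookup_sum lookup_single)
qed

lemma poly_eval_mult [simp]: "poly_eval (p * q) x = poly_eval p x * poly_eval q x"
proof -
  have "poly_eval (p * q) x =
      poly_eval ((\<Sum>m\<in>Poly_Mapping.keys p. Poly_Mapping.single m (Poly_Mapping.lookup p m)) *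
        (\<Sum>m\<in>Poly_Mapping.keys q. Poly_Mapping.single m (Poly_Mapping.lookup q m))) x"
    using poly_mapping_sum_single[of p] poly_mapping_sum_single[of q] by simp
  also have "\<dots> = (\<Sum>m\<in>Poly_Mapping.keys p. \<Sum>m'\<in>Poly_Mapping.keys q.
      Poly_Mapping.lookup p m * Poly_Mapping.lookup q m' * (monom_eval m x * monom_eval m' x))"
    by (simp add: sum_product mult_single poly_eval_single monom_eval_add)
  also have "\<dots> = poly_eval p x * poly_eval q x"
    by (simp add: poly_eval_superset[where M = "Poly_Mapping.keys p" and p = p]
      poly_eval_superset[where M = "Poly_Mapping.keys q" and p = q] sum_product mult_ac)
  finally show ?thesis .
qed

lemma poly_eval_prod [simp]: "poly_eval (prod f I) x = (\<Prod>i\<in>I. poly_eval (f i) x)"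
  by (induction I rule: infinite_finite_induct) auto

lemma poly_eval_scale:
  assumes "homogeneous_poly d p"
  shows "poly_eval p (t *s x) = t ^ d * poly_eval p x"
proof -
  have "monom_eval m (t *s x) = t ^ d * monom_eval m x" if "m \<in> Poly_Mapping.keys p" for m
    using assms that
    by (auto simp: homogeneous_poly_def monom_eval_def power_mult_distrib prod.distrib power_sum)
  then show ?thesis
    by (simp add: poly_eval_superset[where M = "Poly_Mapping.keys p"] sum_distrib_left mult_ac)
qed

section \<open>Linear forms and their coefficient vectors\<close>

definition form_vector :: "('n::finite) cpoly \<Rightarrow> complex ^ 'n" where
  "form_vector p = (\<chi> i. Poly_Mapping.lookup p (Poly_Mapping.single i 1))"

text \<open>Bilinear over the complex numbers, so that kernels are complex subspaces;
  \<open>inner\<close> on this type is real-valued.\<close>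

definition dot :: "complex ^ 'n \<Rightarrow> complex ^ ('n::finite) \<Rightarrow> complex" where
  "dot a x = (\<Sum>i\<in>UNIV. a $ i * x $ i)"

lemma dot_add [simp]: "dot a (x + y) = dot a x + dot a y"
  by (simp add: dot_def distrib_left sum.distrib)

lemma dot_diff [simp]: "dot a (x - y) = dot a x - dot a y"
  by (simp add: dot_def right_diff_distrib sum_subtractf)

lemma dot_scale [simp]: "dot a (c *s x) = c * dot a x"
  by (simp add: dot_def sum_distrib_left mult_ac)

lemma dot_zero [simp]: "dot a 0 = 0"
  by (simp add: dot_def)

lemma exponent_of_degree_one:
  fixes m :: "'n::finite \<Rightarrow>\<^sub>0 nat"
  assumes "(\<Sum>i\<in>UNIV. Poly_Mapping.lookup m i) = 1"
  obtains i where "m = Poly_Mapping.single i 1"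
proof -
  obtain i where i: "Poly_Mapping.lookup m i = 1" "\<forall>j\<in>UNIV. i \<noteq> j \<longrightarrow> Poly_Mapping.lookup m j = 0"
    using assms by (subst (asm) sum_eq_1_iff) auto
  then have "m = Poly_Mapping.single i 1"
    by (intro poly_mapping_eqI) (auto simp: lookup_single when_def)
  then show ?thesis by (rule that)
qed

lemma single_eq_single_one [simp]:
  "Poly_Mapping.single i (Suc 0) = Poly_Mapping.single j (Suc 0) \<longleftrightarrow> i = j"
  by (metis lookup_single_eq lookup_single_not_eq nat.distinct(1))

lemma linear_form_keys:
  fixes p :: "('n::finite) cpoly"
  assumes "homogeneous_poly 1 p"
  shows "Poly_Mapping.keys p \<subseteq> range (\<lambda>i. Poly_Mapping.single i 1)"
  using assms unfolding homogeneous_poly_def by (metis exponent_of_degree_one rangeI subsetI)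

lemma poly_eval_linear_form:
  assumes "homogeneous_poly 1 p"
  shows "poly_eval p x = dot (form_vector p) x"
proof -
  have "poly_eval p x = (\<Sum>m\<in>range (\<lambda>i. Poly_Mapping.single i 1). Poly_Mapping.lookup p m * monom_eval m x)"
    by (rule poly_eval_superset) (use linear_form_keys[OF assms] in auto)
  also have "\<dots> = dot (form_vector p) x"
    by (subst sum.reindex) (auto simp: inj_on_def dot_def form_vector_def monom_eval_single[simplified])
  finally show ?thesis .
qed

lemma partial_deriv_linear_form:
  assumes "homogeneous_poly 1 p"
  shows "partial_deriv i p = Poly_Mapping.single 0 (form_vector p $ i)"
proof -
  let ?e = "Poly_Mapping.single i (1::nat)"
  have "partial_deriv i p =
      (\<Sum>m\<in>Poly_Mapping.keys p. if m = ?e then Poly_Mapping.single 0 (form_vector p $ i) else 0)"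
    unfolding partial_deriv_def
  proof (rule sum.cong)
    fix m assume "m \<in> Poly_Mapping.keys p"
    then obtain j where "m = Poly_Mapping.single j 1"
      using linear_form_keys[OF assms] by auto
    \<comment> \<open>For \<open>j \<noteq> i\<close> the factor \<open>lookup m i\<close> is 0, so
      the truncated exponent does not matter.\<close>
    then show "Poly_Mapping.single (m - ?e) (of_nat (Poly_Mapping.lookup m i) * Poly_Mapping.lookup p m)
        = (if m = ?e then Poly_Mapping.single 0 (form_vector p $ i) else 0)"
      by (auto simp: form_vector_def lookup_single)
  qed simp
  also have "\<dots> = Poly_Mapping.single 0 (form_vector p $ i)"
    by (auto simp: form_vector_def in_keys_iff)
  finally show ?thesis .
qed

section \<open>Divisibility by linear forms on subspaces\<close>

text \<open>Functions instead of formal polynomials: divisibility is needed on subspaces, where only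
  values count, and the rules make substitution and restriction to lines plain inductions.\<close>

inductive polyfun :: "(complex ^ ('n::finite) \<Rightarrow> complex) \<Rightarrow> bool" where
  polyfun_const: "polyfun (\<lambda>x. c)"
| polyfun_coord: "polyfun (\<lambda>x. x $ i)"
| polyfun_add: "polyfun f \<Longrightarrow> polyfun g \<Longrightarrow> polyfun (\<lambda>x. f x + g x)"
| polyfun_mult: "polyfun f \<Longrightarrow> polyfun g \<Longrightarrow> polyfun (\<lambda>x. f x * g x)"

lemma polyfun_sum: "(\<And>i. i \<in> I \<Longrightarrow> polyfun (f i)) \<Longrightarrow> polyfun (\<lambda>x. \<Sum>i\<in>I. f i x)"
  by (induction I rule: infinite_finite_induct) (auto intro: polyfun.intros)

lemma polyfun_prod: "(\<And>i. i \<in> I \<Longrightarrow> polyfun (f i)) \<Longrightarrow> polyfun (\<lambda>x. \<Prod>i\<in>I. f i x)"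
  by (induction I rule: infinite_finite_induct) (auto intro: polyfun.intros)

lemma polyfun_diff:
  assumes "polyfun f" "polyfun g"
  shows "polyfun (\<lambda>x. f x - g x)"
proof -
  have "polyfun (\<lambda>x. f x + (- 1) * g x)"
    by (intro polyfun.intros assms)
  then show ?thesis by simp
qed

lemma polyfun_power: "polyfun f \<Longrightarrow> polyfun (\<lambda>x. f x ^ n)"
  by (induction n) (auto intro: polyfun.intros)

lemma polyfun_dot: "polyfun (dot a)"
  unfolding dot_def by (intro polyfun_sum polyfun.intros)

lemma polyfun_poly_eval: "polyfun (poly_eval p)"
  unfolding poly_eval_def
  by (intro polyfun_sum polyfun_mult polyfun_const polyfun_prod polyfun_power polyfun_coord)

lemmas polyfun_intros =
  polyfun.intros polyfun_sum polyfun_prod polyfun_diff polyfun_power polyfun_dot polyfun_poly_eval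

lemma polyfun_affine_subst:
  assumes "polyfun f"
  shows "polyfun (\<lambda>x. f (x - dot a x *s v))"
  using assms by induction (auto intro!: polyfun_intros)

lemma polyfun_on_line:
  assumes "polyfun f"
  obtains p where "\<And>t. f (x + t *s y) = poly p t"
proof -
  have "\<exists>p. \<forall>t. f (x + t *s y) = poly p t"
    using assms
  proof induction
    case (polyfun_const c)
    show ?case by (rule exI[of _ "[:c:]"]) simp
  next
    case (polyfun_coord i)
    show ?case by (rule exI[of _ "[:x $ i, y $ i:]"]) simp
  next
    case (polyfun_add f g)
    then show ?case by (metis poly_add)
  next
    case (polyfun_mult f g)
    then show ?case by (metis poly_mult)
  qed
  then show ?thesis using that by auto
qed

text \<open>On the line from \<open>x\<close> (\<open>t = 0\<close>) to \<open>y\<close>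
  (\<open>t = 1\<close>), which stays in \<open>W\<close>, both functions become nonzero univariate
  polynomials, and these have no zero divisors.\<close>

lemma polyfun_mult_nonzero:
  assumes "vec.subspace W" "polyfun f" "polyfun g"
    and "\<exists>x\<in>W. f x \<noteq> 0" "\<exists>x\<in>W. g x \<noteq> 0"
  shows "\<exists>x\<in>W. f x * g x \<noteq> 0"
proof (rule ccontr)
  assume zero: "\<not> (\<exists>x\<in>W. f x * g x \<noteq> 0)"
  obtain x y where xy: "x \<in> W" "f x \<noteq> 0" "y \<in> W" "g y \<noteq> 0"
    using assms by auto
  obtain p where p: "\<And>t. f (x + t *s (y - x)) = poly p t"
    using polyfun_on_line[OF assms(2), of x "y - x"] by blast
  obtain q where q: "\<And>t. g (x + t *s (y - x)) = poly q t"
    using polyfun_on_line[OF assms(3), of x "y - x"] by blast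
  have "x + t *s (y - x) \<in> W" for t
    using xy assms(1) by (intro vec.subspace_add vec.subspace_scale vec.subspace_diff)
  then have "poly (p * q) t = 0" for t
    using zero by (auto simp flip: p q)
  then have "p * q = 0"
    using poly_all_0_iff_0 by blast
  then have "p = 0 \<or> q = 0" by simp
  then show False
    using p[of 0] q[of 1] xy by auto
qed

text \<open>Serves to cancel \<open>defining_poly\<close> or a cofactor from an identity, also at
  points where that factor vanishes.\<close>

lemma polyfun_mult_cancel:
  assumes "polyfun f" "\<And>x. f x * g x = 0" "polyfun g" "f x\<^sub>0 \<noteq> 0"
  shows "g x = 0"
  using polyfun_mult_nonzero[OF vec.subspace_UNIV assms(1,3)] assms(2,4) by auto

lemma polyfun_prod_nonzero:
  assumes "vec.subspace W" "finite I"
    and "\<And>i. i \<in> I \<Longrightarrow> polyfun (f i)" "\<And>i. i \<in> I \<Longrightarrow> \<exists>x\<in>W. f i x \<noteq> 0"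
  shows "\<exists>x\<in>W. (\<Prod>i\<in>I. f i x) \<noteq> 0"
  using assms(2-4)
proof (induction I rule: finite_induct)
  case empty
  then show ?case using vec.subspace_0[OF assms(1)] by auto
next
  case (insert i I)
  then show ?case
    using polyfun_mult_nonzero[OF assms(1), of "f i" "\<lambda>x. \<Prod>i\<in>I. f i x"]
    by (simp add: polyfun_prod)
qed

text \<open>Moving the argument by \<open>dot a x\<close> times a fixed vector changes each
  coordinate by a multiple of \<open>dot a x\<close>. Sums and products inherit this, products by
  telescoping the difference.\<close>

lemma polyfun_diff_projection:
  assumes "polyfun f"
  obtains g where "polyfun g" "\<And>x. f x - f (x - dot a x *s v) = dot a x * g x"
proof -
  have "\<exists>g. polyfun g \<and> (\<forall>x. f x - f (x - dot a x *s v) = dot a x * g x)"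
    using assms
  proof induction
    case (polyfun_const c)
    show ?case by (rule exI[of _ "\<lambda>x. 0"]) (auto intro: polyfun_intros)
  next
    case (polyfun_coord i)
    show ?case by (rule exI[of _ "\<lambda>x. v $ i"]) (auto intro: polyfun_intros)
  next
    case (polyfun_add f1 f2)
    then obtain g1 g2 where g: "polyfun g1" "polyfun g2"
      "\<And>x. f1 x - f1 (x - dot a x *s v) = dot a x * g1 x"
      "\<And>x. f2 x - f2 (x - dot a x *s v) = dot a x * g2 x"
      by blast
    have "polyfun (\<lambda>x. g1 x + g2 x)"
      using g by (intro polyfun.polyfun_add)
    moreover have "f1 x + f2 x - (f1 (x - dot a x *s v) + f2 (x - dot a x *s v)) =
        dot a x * (g1 x + g2 x)" for x
      unfolding distrib_left g(3,4)[symmetric] by simp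
    ultimately show ?case by blast
  next
    case (polyfun_mult f1 f2)
    then obtain g1 g2 where g: "polyfun g1" "polyfun g2"
      "\<And>x. f1 x - f1 (x - dot a x *s v) = dot a x * g1 x"
      "\<And>x. f2 x - f2 (x - dot a x *s v) = dot a x * g2 x"
      by blast
    have "f1 x * f2 x - f1 (x - dot a x *s v) * f2 (x - dot a x *s v) =
        dot a x * (g1 x * f2 x + f1 (x - dot a x *s v) * g2 x)" for x
    proof -
      have "f1 x * f2 x - f1 (x - dot a x *s v) * f2 (x - dot a x *s v) =
          (f1 x - f1 (x - dot a x *s v)) * f2 x +
          f1 (x - dot a x *s v) * (f2 x - f2 (x - dot a x *s v))"
        by (simp add: algebra_simps)
      then show ?thesis
        unfolding g(3,4) by (simp add: algebra_simps)
    qed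
    moreover have "polyfun (\<lambda>x. g1 x * f2 x + f1 (x - dot a x *s v) * g2 x)"
      by (intro polyfun.polyfun_add polyfun.polyfun_mult polyfun_affine_subst g polyfun_mult.hyps)
    ultimately show ?case by blast
  qed
  then show ?thesis using that by auto
qed

text \<open>After rescaling to \<open>dot a w = 1\<close>, the map from \<open>x\<close> to
  \<open>x - dot a x *s w\<close> projects \<open>W\<close> onto the kernel of \<open>a\<close> in
  \<open>W\<close>. There \<open>f\<close> vanishes, so the difference in
  \<open>polyfun_diff_projection\<close> is \<open>f x\<close> itself.\<close>

lemma linear_form_dvd_on_subspace:
  assumes W: "vec.subspace W" and v: "v \<in> W" "dot a v \<noteq> 0" and f: "polyfun f"
    and zero: "\<And>x. x \<in> W \<Longrightarrow> dot a x = 0 \<Longrightarrow> f x = 0"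
  obtains g where "polyfun g" "\<And>x. x \<in> W \<Longrightarrow> f x = dot a x * g x"
proof -
  define w where "w = inverse (dot a v) *s v"
  obtain g where g: "polyfun g" "\<And>x. f x - f (x - dot a x *s w) = dot a x * g x"
    using polyfun_diff_projection[OF f, of a w] by blast
  have "f (x - dot a x *s w) = 0" if "x \<in> W" for x
  proof (rule zero)
    show "x - dot a x *s w \<in> W"
      unfolding w_def using that v W by (intro vec.subspace_diff vec.subspace_scale)
    show "dot a (x - dot a x *s w) = 0"
      using v by (simp add: w_def)
  qed
  then have "f x = dot a x * g x" if "x \<in> W" for x
    using g(2)[of x] that by simp
  then show ?thesis using g(1) that by blast
qed

text \<open>The forms are split off one at a time; their being pairwise non-proportional on
  \<open>W\<close> takes the place of coprimality.\<close>

lemma prod_linear_forms_dvd_on_subspace: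
  assumes W: "vec.subspace W" and "finite I" and f: "polyfun f"
    and "\<And>i. i \<in> I \<Longrightarrow> \<exists>v\<in>W. dot (a i) v \<noteq> 0"
    and "\<And>i j. i \<in> I \<Longrightarrow> j \<in> I \<Longrightarrow> i \<noteq> j \<Longrightarrow> \<exists>v\<in>W. dot (a i) v = 0 \<and> dot (a j) v \<noteq> 0"
    and "\<And>i x. i \<in> I \<Longrightarrow> x \<in> W \<Longrightarrow> dot (a i) x = 0 \<Longrightarrow> f x = 0"
  shows "\<exists>g. polyfun g \<and> (\<forall>x\<in>W. f x = (\<Prod>i\<in>I. dot (a i) x) * g x)"
  using assms(2,4-6)
proof (induction I rule: finite_induct)
  case empty
  then show ?case using f by auto
next
  case (insert i I)
  have "\<exists>g. polyfun g \<and> (\<forall>x\<in>W. f x = (\<Prod>i\<in>I. dot (a i) x) * g x)"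
  proof (rule insert.IH)
    show "\<exists>v\<in>W. dot (a j) v \<noteq> 0" if "j \<in> I" for j
      using that by (intro insert.prems(1)) simp
    show "\<exists>v\<in>W. dot (a j) v = 0 \<and> dot (a k) v \<noteq> 0" if "j \<in> I" "k \<in> I" "j \<noteq> k" for j k
      using that by (intro insert.prems(2)) simp_all
    show "f x = 0" if "j \<in> I" "x \<in> W" "dot (a j) x = 0" for j x
      using that by (intro insert.prems(3)[of j]) simp_all
  qed
  then obtain g where g: "polyfun g" "\<And>x. x \<in> W \<Longrightarrow> f x = (\<Prod>i\<in>I. dot (a i) x) * g x"
    by blast
  let ?W = "{x\<in>W. dot (a i) x = 0}"
  have sub: "vec.subspace ?W"
    using W by (auto simp: vec.subspace_def)
  \<comment> \<open>On the kernel of \<open>a i\<close> in \<open>W\<close> the product over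
    \<open>I\<close> is not identically zero, but its product with \<open>g\<close> is
    \<open>f = 0\<close>; so \<open>g\<close> vanishes there.\<close>
  have "\<exists>x\<in>?W. (\<Prod>j\<in>I. dot (a j) x) \<noteq> 0"
    using insert.hyps insert.prems(2)[of i] by (intro polyfun_prod_nonzero sub polyfun_dot) auto
  moreover have "(\<Prod>j\<in>I. dot (a j) x) * g x = 0" if "x \<in> ?W" for x
    using that g(2)[of x] insert.prems(3)[of i x] by simp
  ultimately have zero: "g x = 0" if "x \<in> ?W" for x
    using that polyfun_mult_nonzero[OF sub polyfun_prod[OF polyfun_dot] g(1)] by blast
  obtain v where v: "v \<in> W" "dot (a i) v \<noteq> 0"
    using insert.prems(1) by blast
  obtain h where "polyfun h" "\<And>x. x \<in> W \<Longrightarrow> g x = dot (a i) x * h x"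
    using linear_form_dvd_on_subspace[OF W v g(1)] zero by blast
  then show ?case
    using g(2) insert.hyps by (intro exI[of _ h]) (simp add: mult_ac)
qed

text \<open>Meant for \<open>l = \<theta>(\<alpha>)/\<alpha>\<close> with \<open>\<theta>\<close> of
  degree \<open>d\<close>, a quotient of degree \<open>d - 1\<close>. As \<open>0 ^ 0 = 1\<close>,
  the second claim gives \<open>l x = l 0\<close> for \<open>d = 1\<close> and
  \<open>l 0 = 0\<close> for \<open>d \<ge> 2\<close>.\<close>

lemma polyfun_line_scaling:
  assumes "polyfun l" and "dot a x \<noteq> 0"
    and scale: "\<And>t. dot a (t *s x) * l (t *s x) = t ^ d * (dot a x * l x)"
  shows "d = 0 \<Longrightarrow> l x = 0" and "d \<ge> 1 \<Longrightarrow> l 0 = 0 ^ (d - 1) * l x"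
proof -
  have eq: "t * l (t *s x) = t ^ d * l x" for t
    using scale[of t] assms(2) by simp
  from eq[of 0] show "d = 0 \<Longrightarrow> l x = 0" by simp
  assume "d \<ge> 1"
  then obtain e where d: "d = Suc e" by (cases d) auto
  obtain p where p: "\<And>t. l (0 + t *s x) = poly p t"
    using polyfun_on_line[OF assms(1)] by blast
  \<comment> \<open>The factor \<open>t\<close> is cancelled between polynomials, since the value at
    \<open>t = 0\<close> is the one wanted.\<close>
  have "poly ([:0, 1:] * p) t = poly ([:0, 1:] * monom (l x) e) t" for t
    using eq[of t] p[of t] by (simp add: d poly_monom mult_ac)
  then have "poly ([:0, 1:] * p) = poly ([:0, 1:] * monom (l x) e)" ..
  then have "p = monom (l x) e"
    by (subst (asm) poly_eq_poly_eq_iff) simp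
  then show "l 0 = 0 ^ (d - 1) * l x"
    using p[of 0] d by (simp add: poly_monom)
qed

section \<open>Logarithmic forms dual to a free derivation module\<close>

definition eval_deriv :: "('n::finite) derivation \<Rightarrow> complex ^ 'n \<Rightarrow> complex ^ 'n" where
  "eval_deriv \<theta> x = (\<chi> i. poly_eval (\<theta> $ i) x)"

text \<open>The directional derivative \<open>\<partial>\<^sub>v\<close>.\<close>

definition const_deriv :: "complex ^ ('n::finite) \<Rightarrow> 'n derivation" where
  "const_deriv v = (\<chi> i. Poly_Mapping.single 0 (v $ i))"

lemma apply_deriv_linear_form:
  assumes "homogeneous_poly 1 p"
  shows "apply_deriv \<theta> p = (\<Sum>i\<in>UNIV. \<theta> $ i * Poly_Mapping.single 0 (form_vector p $ i))"
  by (simp add: apply_deriv_def partial_deriv_linear_form[OF assms])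

lemma eval_apply_deriv:
  assumes "homogeneous_poly 1 p"
  shows "poly_eval (apply_deriv \<theta> p) x = dot (form_vector p) (eval_deriv \<theta> x)"
  by (simp add: apply_deriv_linear_form[OF assms] dot_def eval_deriv_def mult.commute)

lemma single_sum: "(\<Sum>i\<in>I. Poly_Mapping.single m (f i)) = Poly_Mapping.single m (\<Sum>i\<in>I. f i)"
  by (induction I rule: infinite_finite_induct) (auto simp: single_add)

lemma apply_const_deriv:
  assumes "homogeneous_poly 1 p"
  shows "apply_deriv (q *s const_deriv v) p = q * Poly_Mapping.single 0 (dot (form_vector p) v)"
proof -
  have "apply_deriv (q *s const_deriv v) p =
      q * (\<Sum>i\<in>UNIV. Poly_Mapping.single 0 (form_vector p $ i * v $ i))"
    by (simp add: apply_deriv_linear_form[OF assms] const_deriv_def sum_distrib_left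
        mult.assoc mult_single mult.commute[of "v $ _"])
  also have "(\<Sum>i\<in>UNIV. Poly_Mapping.single 0 (form_vector p $ i * v $ i))
      = (Poly_Mapping.single 0 (dot (form_vector p) v) :: 'a cpoly)"
    unfolding dot_def by (rule single_sum)
  finally show ?thesis .
qed

lemma eval_deriv_add [simp]: "eval_deriv (\<theta> + \<theta>') x = eval_deriv \<theta> x + eval_deriv \<theta>' x"
  by (simp add: eval_deriv_def vec_eq_iff)

lemma eval_deriv_zero [simp]: "eval_deriv 0 x = 0"
  by (simp add: eval_deriv_def vec_eq_iff)

lemma eval_deriv_scale [simp]: "eval_deriv (q *s \<theta>) x = poly_eval q x *s eval_deriv \<theta> x"
  by (simp add: eval_deriv_def vec_eq_iff)

lemma eval_const_deriv [simp]: "eval_deriv (const_deriv v) x = v"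
  by (simp add: eval_deriv_def const_deriv_def vec_eq_iff)

text \<open>For \<open>q = Q\<close> every summand lies in \<open>D(A)\<close>, although
  \<open>\<partial>\<^sub>i\<close> alone in general does not; so coordinates can be taken
  termwise.\<close>

lemma scale_eq_sum_const_deriv:
  "q *s \<theta> = (\<Sum>i\<in>UNIV. \<theta> $ i *s (q *s const_deriv (axis i 1)))"
proof -
  have "(\<Sum>i\<in>UNIV. \<theta> $ i * (q * Poly_Mapping.single 0 (axis i 1 $ j))) = q * \<theta> $ j" for j
  proof -
    have "(\<Sum>i\<in>UNIV. \<theta> $ i * (q * Poly_Mapping.single 0 (axis i 1 $ j)))
        = (\<Sum>i\<in>UNIV. if i = j then q * \<theta> $ j else 0)"
      by (rule sum.cong) (auto simp: axis_def)
    then show ?thesis by simp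
  qed
  then show ?thesis
    by (simp add: vec_eq_iff const_deriv_def flip: mult.assoc)
qed

text \<open>\<open>double\<close> expresses the absence of lines of multiplicity above 2 without
  dimensions, so the argument runs in \<open>complex ^ 'n\<close>.\<close>

locale generic_free_arrangement =
  fixes A :: "(complex ^ ('n::finite)) set set"
    and \<alpha> :: "(complex ^ 'n) set \<Rightarrow> 'n cpoly"
    and B :: "'n derivation set"
  assumes finite_A: "finite A"
    and linear: "H \<in> A \<Longrightarrow> homogeneous_poly 1 (\<alpha> H)"
    and kernel: "H \<in> A \<Longrightarrow> {x. poly_eval (\<alpha> H) x = 0} = H"
    and proper: "H \<in> A \<Longrightarrow> \<exists>v. v \<notin> H"
    and distinct: "H \<in> A \<Longrightarrow> K \<in> A \<Longrightarrow> H \<noteq> K \<Longrightarrow> \<exists>v\<in>H. v \<notin> K"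
    and double: "H \<in> A \<Longrightarrow> K \<in> A \<Longrightarrow> J \<in> A \<Longrightarrow> H \<noteq> K \<Longrightarrow> H \<noteq> J \<Longrightarrow> K \<noteq> J \<Longrightarrow>
      \<exists>v\<in>H \<inter> K. v \<notin> J"
    and independent: "der.independent B"
    and span: "der.span B = derivation_module A \<alpha>"
    and homogeneous: "b \<in> B \<Longrightarrow> \<exists>d. homogeneous_deriv d b"
begin

abbreviation normal :: "(complex ^ 'n) set \<Rightarrow> complex ^ 'n" where
  "normal H \<equiv> form_vector (\<alpha> H)"

abbreviation D :: "'n derivation set" where
  "D \<equiv> derivation_module A \<alpha>"

section \<open>The defining polynomial \<open>Q\<close>, its cofactors
  \<open>Q/\<alpha>\<^sub>H\<close> and the members of \<open>D(A)\<close> built from them\<close>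

definition defining_poly :: "complex ^ 'n \<Rightarrow> complex" where
  "defining_poly x = (\<Prod>H\<in>A. dot (normal H) x)"

definition cofactor :: "(complex ^ 'n) set \<Rightarrow> complex ^ 'n \<Rightarrow> complex" where
  "cofactor H x = (\<Prod>K\<in>A - {H}. dot (normal K) x)"

lemma eval_form: "H \<in> A \<Longrightarrow> poly_eval (\<alpha> H) x = dot (normal H) x"
  by (rule poly_eval_linear_form[OF linear])

lemma mem_iff: "H \<in> A \<Longrightarrow> x \<in> H \<longleftrightarrow> dot (normal H) x = 0"
  using kernel[of H] eval_form[of H x] by (metis (mono_tags, lifting) mem_Collect_eq)

lemma subspace: "H \<in> A \<Longrightarrow> vec.subspace H"
  unfolding vec.subspace_def by (simp add: mem_iff)

lemma nonzero: "H \<in> A \<Longrightarrow> \<exists>v. dot (normal H) v \<noteq> 0"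
  using proper[of H] by (simp add: mem_iff)

lemma polyfun_defining_poly: "polyfun defining_poly"
  unfolding defining_poly_def by (intro polyfun_prod polyfun_dot)

lemma polyfun_cofactor: "polyfun (cofactor H)"
  unfolding cofactor_def by (intro polyfun_prod polyfun_dot)

lemma defining_poly_cofactor:
  "H \<in> A \<Longrightarrow> defining_poly x = dot (normal H) x * cofactor H x"
  unfolding defining_poly_def cofactor_def by (rule prod.remove[OF finite_A])

lemma eval_defining_poly: "poly_eval (\<Prod>H\<in>A. \<alpha> H) x = defining_poly x"
  by (simp add: defining_poly_def eval_form)

lemma eval_cofactor: "poly_eval (\<Prod>K\<in>A - {H}. \<alpha> K) x = cofactor H x"
  by (simp add: cofactor_def eval_form)

lemma defining_poly_nonzero: "\<exists>x. defining_poly x \<noteq> 0"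
  unfolding defining_poly_def
  using polyfun_prod_nonzero[OF vec.subspace_UNIV finite_A polyfun_dot, of normal] nonzero by simp

lemma cofactor_nonzero:
  assumes "H \<in> A"
  shows "\<exists>x\<in>H. cofactor H x \<noteq> 0"
  unfolding cofactor_def
proof (rule polyfun_prod_nonzero)
  fix K assume "K \<in> A - {H}"
  then show "\<exists>x\<in>H. dot (normal K) x \<noteq> 0"
    using distinct[of H K] assms by (auto simp: mem_iff)
qed (use finite_A subspace[OF assms] polyfun_dot in auto)

lemma cofactor_eq_0: "K \<in> A \<Longrightarrow> K \<noteq> H \<Longrightarrow> x \<in> K \<Longrightarrow> cofactor H x = 0"
  unfolding cofactor_def using finite_A by (auto simp: mem_iff)

lemma defining_poly_deriv_mem: "(\<Prod>H\<in>A. \<alpha> H) *s const_deriv v \<in> D"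
  unfolding derivation_module_def
  using finite_A by (auto simp: apply_const_deriv[OF linear] intro!: dvd_mult2 dvd_prodI)

text \<open>For \<open>K \<noteq> H\<close> the factor \<open>\<alpha> K\<close> is present; the
  missing \<open>\<alpha> H\<close> is made up for by the derivative of \<open>\<alpha> H\<close>
  along \<open>v\<close> being 0.\<close>

lemma cofactor_deriv_mem:
  assumes "H \<in> A" "v \<in> H"
  shows "(\<Prod>K\<in>A - {H}. \<alpha> K) *s const_deriv v \<in> D"
proof -
  have "\<alpha> K dvd (\<Prod>K\<in>A - {H}. \<alpha> K) * Poly_Mapping.single 0 (dot (normal K) v)" if "K \<in> A" for K
  proof (cases "K = H")
    case True
    then show ?thesis using assms by (simp add: mem_iff)
  next
    case False
    then show ?thesis using finite_A that by (intro dvd_mult2 dvd_prodI) auto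
  qed
  then show ?thesis
    by (simp add: derivation_module_def apply_const_deriv[OF linear])
qed

lemma quotient_eval:
  assumes "H \<in> A" "apply_deriv \<theta> (\<alpha> H) = \<alpha> H * l"
  shows "dot (normal H) (eval_deriv \<theta> x) = dot (normal H) x * poly_eval l x"
  using eval_apply_deriv[OF linear[OF assms(1)], of \<theta> x] assms by (simp add: eval_form)

section \<open>Coordinate functionals as logarithmic forms and their residues\<close>

definition coord :: "'n derivation \<Rightarrow> 'n derivation \<Rightarrow> complex ^ 'n \<Rightarrow> complex" where
  "coord b \<theta> x = poly_eval (der.representation B \<theta> b) x"

text \<open>The vector \<open>\<eta>\<close>: the logarithmic form dual to \<open>b\<close> with its
  denominator \<open>Q\<close> cleared.\<close>

definition log_form :: "'n derivation \<Rightarrow> complex ^ 'n \<Rightarrow> complex ^ 'n" where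
  "log_form b x = (\<chi> i. coord b ((\<Prod>H\<in>A. \<alpha> H) *s const_deriv (axis i 1)) x)"

lemma polyfun_coord: "polyfun (coord b \<theta>)"
  unfolding coord_def by (rule polyfun_poly_eval)

lemma polyfun_log_form: "polyfun (\<lambda>x. log_form b x $ i)"
  by (simp add: log_form_def polyfun_coord)

lemma polyfun_log_form_dot: "polyfun (\<lambda>x. dot (log_form b x) v)"
  unfolding dot_def by (intro polyfun_sum polyfun.polyfun_mult polyfun_log_form polyfun_const)

text \<open>Coordinates are linear over polynomials; they are applied to \<open>Q \<theta> =
  \<Sum>\<^sub>i \<theta>\<^sub>i (Q \<partial>\<^sub>i)\<close>.\<close>

lemma coord_eq_log_form:
  assumes "\<theta> \<in> D"
  shows "defining_poly x * coord b \<theta> x = dot (log_form b x) (eval_deriv \<theta> x)"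
proof -
  let ?Q = "\<Prod>H\<in>A. \<alpha> H"
  let ?r = "der.representation B"
  have D: "\<theta> \<in> der.span B" "?Q *s const_deriv (axis i 1) \<in> der.span B" for i
    unfolding span by (fact assms defining_poly_deriv_mem)+
  have "?Q * ?r \<theta> b = ?r (?Q *s \<theta>) b"
    by (simp add: der.representation_scale[OF independent D(1)])
  also have "\<dots> = ?r (\<Sum>i\<in>UNIV. \<theta> $ i *s (?Q *s const_deriv (axis i 1))) b"
    by (subst scale_eq_sum_const_deriv) (rule refl)
  also have "\<dots> = (\<Sum>i\<in>UNIV. \<theta> $ i * ?r (?Q *s const_deriv (axis i 1)) b)"
    using der.representation_sum[OF independent, of UNIV "\<lambda>i. \<theta> $ i *s (?Q *s const_deriv (axis i 1))"]
      der.span_scale[OF D(2)]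
    by (simp only: der.representation_scale[OF independent D(2)])
  finally have "poly_eval (?Q * ?r \<theta> b) x =
      poly_eval (\<Sum>i\<in>UNIV. \<theta> $ i * ?r (?Q *s const_deriv (axis i 1)) b) x"
    by simp
  then show ?thesis
    by (simp add: eval_defining_poly coord_def log_form_def dot_def eval_deriv_def mult.commute
        del: poly_eval_prod)
qed

lemma log_form_vanishes:
  assumes "H \<in> A" "v \<in> H" "x \<in> H"
  shows "dot (log_form b x) v = 0"
proof -
  let ?\<theta> = "(\<Prod>K\<in>A - {H}. \<alpha> K) *s const_deriv v"
  \<comment> \<open>For \<open>(Q/\<alpha>\<^sub>H) \<partial>\<^sub>v\<close> both sides of
    \<open>coord_eq_log_form\<close> contain the cofactor. Cancelling it leaves
    \<open>dot (log_form b y) v\<close> as a multiple of \<open>dot (normal H) y\<close>.\<close>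
  have "cofactor H y * (dot (log_form b y) v - dot (normal H) y * coord b ?\<theta> y) = 0" for y
    using coord_eq_log_form[OF cofactor_deriv_mem[OF assms(1,2)], of y b]
    by (auto simp: eval_cofactor defining_poly_cofactor[OF assms(1)] algebra_simps simp del: poly_eval_prod)
  moreover have "polyfun (\<lambda>y. dot (log_form b y) v - dot (normal H) y * coord b ?\<theta> y)"
    by (intro polyfun_diff polyfun.polyfun_mult polyfun_dot polyfun_coord polyfun_log_form_dot)
  moreover obtain y where "cofactor H y \<noteq> 0"
    using cofactor_nonzero[OF assms(1)] by blast
  ultimately have "dot (log_form b x) v - dot (normal H) x * coord b ?\<theta> x = 0"
    by (rule polyfun_mult_cancel[OF polyfun_cofactor])
  then show ?thesis
    using assms by (simp add: mem_iff)
qed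

lemma dot_axis: "dot a (axis i 1) = a $ i"
  by (simp add: dot_def axis_def if_distrib cong: if_cong)

text \<open>\<open>\<eta>\<close> annihilates \<open>H\<close>, hence is a multiple of its normal;
  pairing with \<open>w\<close> reads off the multiple.\<close>

lemma log_form_on_hyperplane:
  assumes "H \<in> A" "x \<in> H" "dot (normal H) w = 1"
  shows "log_form b x $ i = dot (log_form b x) w * normal H $ i"
proof -
  have "axis i 1 - (normal H $ i) *s w \<in> H"
    using assms by (simp add: mem_iff dot_axis)
  from log_form_vanishes[OF assms(1) this assms(2)] show ?thesis
    by (simp add: dot_axis mult.commute)
qed

text \<open>At a common point \<open>\<eta>\<close> annihilates both \<open>H\<close> and
  \<open>K\<close>, and \<open>H + K\<close> is the whole space.\<close>

lemma log_form_eq_0: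
  assumes "H \<in> A" "K \<in> A" "H \<noteq> K" "x \<in> H" "x \<in> K"
  shows "dot (log_form b x) u = 0"
proof -
  obtain v where v: "v \<in> H" "dot (normal K) v \<noteq> 0"
    using distinct[OF assms(1-3)] mem_iff[OF assms(2)] by auto
  have "u - (dot (normal K) u / dot (normal K) v) *s v \<in> K"
    using assms v by (simp add: mem_iff)
  from log_form_vanishes[OF assms(2) this assms(5)] log_form_vanishes[OF assms(1) v(1) assms(4)]
  show ?thesis by simp
qed

text \<open>\<open>f\<close> is the residue of the logarithmic form along \<open>H\<close>; its
  being polynomial is what the double lines provide.\<close>

lemma residue:
  assumes "H \<in> A"
  shows "\<exists>f. polyfun f \<and> (\<forall>x\<in>H. \<forall>i. log_form b x $ i = f x * cofactor H x * normal H $ i)"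
proof -
  obtain v where "dot (normal H) v \<noteq> 0"
    using nonzero[OF assms] by blast
  then have w: "dot (normal H) (inverse (dot (normal H) v) *s v) = 1" (is "dot _ ?w = 1")
    by simp
  have "\<exists>f. polyfun f \<and>
      (\<forall>x\<in>H. dot (log_form b x) ?w = (\<Prod>K\<in>A - {H}. dot (normal K) x) * f x)"
  proof (rule prod_linear_forms_dvd_on_subspace)
    show "\<exists>v\<in>H. dot (normal K) v \<noteq> 0" if "K \<in> A - {H}" for K
      using distinct[of H K] assms that by (auto simp: mem_iff)
    \<comment> \<open>\<open>double\<close> makes the other forms pairwise non-proportional on
      \<open>H\<close>, so the zeros of \<open>\<eta>\<close> on each \<open>H \<inter> K\<close>
      give divisibility by the whole cofactor.\<close>
    show "\<exists>v\<in>H. dot (normal K) v = 0 \<and> dot (normal J) v \<noteq> 0"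
      if "K \<in> A - {H}" "J \<in> A - {H}" "K \<noteq> J" for K J
      using double[of H K J] mem_iff[of K] mem_iff[of J] assms that by auto
    show "dot (log_form b x) ?w = 0" if "K \<in> A - {H}" "x \<in> H" "dot (normal K) x = 0" for K x
      using log_form_eq_0[of H K] assms that by (auto simp: mem_iff)
  qed (use finite_A subspace[OF assms] polyfun_log_form_dot in \<open>auto simp del: dot_scale\<close>)
  then show ?thesis
    using log_form_on_hyperplane[OF assms _ w] by (metis cofactor_def mult.commute)
qed

text \<open>Subtracting from \<open>\<eta>\<close> the polar part of each hyperplane leaves a vector
  divisible by \<open>Q\<close>. In the pairing with \<open>\<theta>\<close>, the relation
  \<open>\<theta>(\<alpha>\<^sub>H) = \<alpha>\<^sub>H l\<^sub>H\<close> removes the remaining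
  denominators.\<close>

lemma coord_formula:
  assumes \<theta>: "\<theta> \<in> D" and l: "\<And>H. H \<in> A \<Longrightarrow> apply_deriv \<theta> (\<alpha> H) = \<alpha> H * l H"
  shows "\<exists>f \<zeta>. \<forall>x. coord b \<theta> x =
        (\<Sum>H\<in>A. f H x * poly_eval (l H) x) + (\<Sum>i\<in>UNIV. \<zeta> i x * eval_deriv \<theta> x $ i)"
proof -
  obtain f where f: "\<And>H. H \<in> A \<Longrightarrow> polyfun (f H)"
    "\<And>H x i. H \<in> A \<Longrightarrow> x \<in> H \<Longrightarrow> log_form b x $ i = f H x * cofactor H x * normal H $ i"
    using residue[of _ b] by metis
  have "\<exists>g. polyfun g \<and> (\<forall>x\<in>UNIV. log_form b x $ i - (\<Sum>H\<in>A. f H x * cofactor H x * normal H $ i) =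
      (\<Prod>H\<in>A. dot (normal H) x) * g x)" for i
  proof (rule prod_linear_forms_dvd_on_subspace)
    show "polyfun (\<lambda>x. log_form b x $ i - (\<Sum>H\<in>A. f H x * cofactor H x * normal H $ i))"
      by (intro polyfun_diff polyfun_sum polyfun.polyfun_mult polyfun_log_form polyfun_cofactor
          polyfun_const f)
    show "\<exists>v\<in>UNIV. dot (normal K) v = 0 \<and> dot (normal J) v \<noteq> 0"
      if "K \<in> A" "J \<in> A" "K \<noteq> J" for K J
      using distinct[of K J] that by (auto simp: mem_iff)
    show "log_form b x $ i - (\<Sum>H\<in>A. f H x * cofactor H x * normal H $ i) = 0"
      if "K \<in> A" "dot (normal K) x = 0" for K x
    proof -
      have "x \<in> K" using that by (simp add: mem_iff)
      \<comment> \<open>On \<open>K\<close> the other cofactors vanish, and the summand of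
        \<open>K\<close> equals \<open>log_form b x $ i\<close> by the choice of
        \<open>f\<close>.\<close>
      then have "(\<Sum>H\<in>A - {K}. f H x * cofactor H x * normal H $ i) = 0"
        using that cofactor_eq_0[of K _ x] by (intro sum.neutral) auto
      then show ?thesis
        using f(2)[OF \<open>K \<in> A\<close> \<open>x \<in> K\<close>] by (simp add: sum.remove[OF finite_A \<open>K \<in> A\<close>])
    qed
  qed (use finite_A nonzero vec.subspace_UNIV in auto)
  then obtain \<zeta> where \<zeta>: "\<And>i. polyfun (\<zeta> i)"
    "\<And>i x. log_form b x $ i - (\<Sum>H\<in>A. f H x * cofactor H x * normal H $ i) = defining_poly x * \<zeta> i x"
    unfolding defining_poly_def by (metis UNIV_I)
  show ?thesis
  proof (intro exI allI)
    fix x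
    let ?rhs = "\<lambda>x. (\<Sum>H\<in>A. f H x * poly_eval (l H) x) + (\<Sum>i\<in>UNIV. \<zeta> i x * eval_deriv \<theta> x $ i)"
    \<comment> \<open>The identity is proved times \<open>Q\<close>; cancelling \<open>Q\<close>
      afterwards makes it valid on the hyperplanes too, above all at the origin.\<close>
    have "defining_poly y * coord b \<theta> y = defining_poly y * ?rhs y" for y
    proof -
      have log_form: "log_form b y $ i =
          (\<Sum>H\<in>A. f H y * cofactor H y * normal H $ i) + defining_poly y * \<zeta> i y" for i
        using \<zeta>(2)[of y i] by (simp add: algebra_simps)
      have "(\<Sum>i\<in>UNIV. (\<Sum>H\<in>A. f H y * cofactor H y * normal H $ i) * eval_deriv \<theta> y $ i)
          = (\<Sum>H\<in>A. f H y * cofactor H y * dot (normal H) (eval_deriv \<theta> y))"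
        unfolding dot_def sum_distrib_left sum_distrib_right
        by (subst sum.swap) (simp add: mult_ac)
      also have "\<dots> = (\<Sum>H\<in>A. defining_poly y * (f H y * poly_eval (l H) y))"
        by (rule sum.cong)
          (simp_all add: quotient_eval[OF _ l] defining_poly_cofactor mult_ac)
      finally show ?thesis
        unfolding coord_eq_log_form[OF \<theta>] unfolding dot_def log_form
        by (simp add: distrib_right distrib_left sum.distrib sum_distrib_left mult_ac)
    qed
    then have "defining_poly y * (coord b \<theta> y - ?rhs y) = 0" for y
      by (simp add: right_diff_distrib)
    moreover have "polyfun (\<lambda>y. coord b \<theta> y - ?rhs y)"
      unfolding eval_deriv_def vec_lambda_beta
      by (intro polyfun_diff polyfun.polyfun_add polyfun_sum polyfun.polyfun_mult polyfun_coord
          polyfun_poly_eval f \<zeta>)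
    moreover obtain y where "defining_poly y \<noteq> 0"
      using defining_poly_nonzero by blast
    ultimately have "coord b \<theta> x - ?rhs x = 0"
      by (rule polyfun_mult_cancel[OF polyfun_defining_poly])
    then show "coord b \<theta> x = ?rhs x" by simp
  qed
qed

section \<open>Degrees and eigenvalues of the basis elements\<close>

lemma eval_deriv_homogeneous:
  "homogeneous_deriv d \<theta> \<Longrightarrow> eval_deriv \<theta> (t *s x) = t ^ d *s eval_deriv \<theta> x"
  by (simp add: homogeneous_deriv_def eval_deriv_def vec_eq_iff poly_eval_scale)

lemma quotient_scale:
  assumes "H \<in> A" "apply_deriv \<theta> (\<alpha> H) = \<alpha> H * l" "homogeneous_deriv d \<theta>"
  shows "dot (normal H) (t *s x) * poly_eval l (t *s x) = t ^ d * (dot (normal H) x * poly_eval l x)"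
  using quotient_eval[OF assms(1,2), of "t *s x"] quotient_eval[OF assms(1,2), of x]
  by (auto simp: eval_deriv_homogeneous[OF assms(3)])

lemma quotients_exist:
  assumes "\<theta> \<in> D"
  obtains l where "\<And>H. H \<in> A \<Longrightarrow> apply_deriv \<theta> (\<alpha> H) = \<alpha> H * l H"
  using assms unfolding derivation_module_def dvd_def by (auto simp: Ball_def) metis

text \<open>For \<open>d \<ge> 2\<close> both \<open>b\<close> and its quotients \<open>l H\<close>
  vanish at the origin, hence so does the right side of \<open>coord_formula\<close>; but the
  coordinate of \<open>b\<close> at \<open>b\<close> is 1.\<close>

lemma basis_degree_le_1:
  assumes "b \<in> B" "homogeneous_deriv d b"
  shows "d \<le> 1"
proof (rule ccontr)
  assume "\<not> d \<le> 1"
  then have d: "d \<ge> 1" "0 ^ (d - 1) = (0::complex)" "0 ^ d = (0::complex)"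
    by auto
  have "b \<in> D"
    using assms(1) der.span_base span by blast
  obtain l where l: "\<And>H. H \<in> A \<Longrightarrow> apply_deriv b (\<alpha> H) = \<alpha> H * l H"
    using quotients_exist[OF \<open>b \<in> D\<close>] by blast
  have "poly_eval (l H) 0 = 0" if H: "H \<in> A" for H
  proof -
    obtain v where "dot (normal H) v \<noteq> 0"
      using nonzero[OF H] by blast
    from polyfun_line_scaling(2)[OF polyfun_poly_eval this quotient_scale[OF H l[OF H] assms(2)] d(1)] d(2)
    show ?thesis by simp
  qed
  moreover have "eval_deriv b 0 = 0"
    using eval_deriv_homogeneous[OF assms(2), of 0 0] d(3) by simp
  moreover obtain f \<zeta> where "\<forall>x. coord b b x =
      (\<Sum>H\<in>A. f H x * poly_eval (l H) x) + (\<Sum>i\<in>UNIV. \<zeta> i x * eval_deriv b x $ i)"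
    using exE[OF coord_formula[OF \<open>b \<in> D\<close>, of l b]] l by blast
  ultimately have "coord b b 0 = 0" by simp
  moreover have "coord b b 0 = 1"
    by (simp add: coord_def der.representation_basis[OF independent assms(1)])
  ultimately show False by simp
qed

lemma basis_eigenvalue:
  assumes "b \<in> B" "H \<in> A"
  shows "\<exists>\<mu>. \<forall>x. dot (normal H) (eval_deriv b x) = \<mu> * dot (normal H) x"
proof -
  obtain d where d: "homogeneous_deriv d b"
    using homogeneous[OF assms(1)] by blast
  have "b \<in> D"
    using assms(1) der.span_base span by blast
  then obtain l where l: "apply_deriv b (\<alpha> H) = \<alpha> H * l"
    using assms(2) by (auto simp: derivation_module_def elim: dvdE)
  note scaling = polyfun_line_scaling[OF polyfun_poly_eval _ quotient_scale[OF assms(2) l d]]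
  \<comment> \<open>Off the kernel of \<open>normal H\<close> the quotient is 0 in degree 0 and
    constant in degree 1; on the kernel both sides vanish.\<close>
  have "dot (normal H) x * poly_eval l x = dot (normal H) x * (if d = 0 then 0 else poly_eval l 0)" for x
    using scaling[of x] basis_degree_le_1[OF assms(1) d]
    by (cases "dot (normal H) x = 0"; cases d) auto
  then show ?thesis
    using quotient_eval[OF assms(2) l] by (metis mult.commute)
qed

text \<open>If \<open>\<Sum>\<^sub>H c\<^sub>H d\<alpha>\<^sub>H/\<alpha>\<^sub>H\<close> kills the
  basis, it kills all of \<open>D(A)\<close>, in particular \<open>Q \<partial>\<^sub>v\<close>, and
  so is zero. Its residue along \<open>K\<close> is \<open>c K\<close>.\<close>

lemma log_forms_independent:
  assumes \<mu>: "\<And>b H x. b \<in> B \<Longrightarrow> H \<in> A \<Longrightarrow> dot (normal H) (eval_deriv b x) = \<mu> b H * dot (normal H) x"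
    and rel: "\<And>b. b \<in> B \<Longrightarrow> (\<Sum>H\<in>A. c H * \<mu> b H) = 0" and "K \<in> A"
  shows "c K = 0"
proof -
  \<comment> \<open>This is \<open>Q\<close> times the value of the logarithmic form on
    \<open>\<theta>\<close>, which is linear over polynomials; so induction over the span
    applies.\<close>
  have zero: "(\<Sum>H\<in>A. c H * cofactor H x * dot (normal H) (eval_deriv \<theta> x)) = 0" if "\<theta> \<in> D" for \<theta> x
  proof -
    have "\<theta> \<in> der.span B" using that span by simp
    then show ?thesis
    proof (induction rule: der.span_induct_alt)
      case base
      show ?case by simp
    next
      case (step q b \<theta>)
      have "(\<Sum>H\<in>A. c H * cofactor H x * dot (normal H) (eval_deriv b x)) =
          (\<Sum>H\<in>A. defining_poly x * (c H * \<mu> b H))"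
        by (rule sum.cong) (simp_all add: \<mu> step.hyps defining_poly_cofactor mult_ac)
      also have "\<dots> = 0"
        using rel[OF step.hyps(1)] by (simp flip: sum_distrib_left)
      finally have "poly_eval q x * (\<Sum>H\<in>A. c H * cofactor H x * dot (normal H) (eval_deriv b x)) = 0"
        by simp
      then show ?case
        using step.IH by (simp add: distrib_left sum.distrib sum_distrib_left mult_ac)
    qed
  qed
  obtain v where v: "dot (normal K) v \<noteq> 0"
    using nonzero[OF \<open>K \<in> A\<close>] by blast
  have "defining_poly x * (\<Sum>H\<in>A. c H * cofactor H x * dot (normal H) v) = 0" for x
    using zero[OF defining_poly_deriv_mem, of x v]
    by (simp add: eval_defining_poly sum_distrib_left mult_ac del: poly_eval_prod)
  moreover have "polyfun (\<lambda>x. \<Sum>H\<in>A. c H * cofactor H x * dot (normal H) v)"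
    by (intro polyfun_sum polyfun.polyfun_mult polyfun_const polyfun_cofactor)
  moreover obtain y where "defining_poly y \<noteq> 0"
    using defining_poly_nonzero by blast
  ultimately have sum0: "(\<Sum>H\<in>A. c H * cofactor H x * dot (normal H) v) = 0" for x
    by (rule polyfun_mult_cancel[OF polyfun_defining_poly])
  \<comment> \<open>At a point of \<open>K\<close> on no other hyperplane only the summand of
    \<open>K\<close> survives.\<close>
  obtain x where x: "x \<in> K" "cofactor K x \<noteq> 0"
    using cofactor_nonzero[OF \<open>K \<in> A\<close>] by blast
  have "(\<Sum>H\<in>A - {K}. c H * cofactor H x * dot (normal H) v) = 0"
    using cofactor_eq_0[OF \<open>K \<in> A\<close> _ x(1)] by (intro sum.neutral) auto
  then show ?thesis
    using sum0[of x] x v by (simp add: sum.remove[OF finite_A \<open>K \<in> A\<close>])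
qed

text \<open>Each hyperplane has a vector of eigenvalues, one entry per basis element. A linear
  relation between these vectors is one between the forms
  \<open>d\<alpha>\<^sub>H/\<alpha>\<^sub>H\<close>, so they are independent.\<close>

theorem card_le:
  assumes "finite B" "card B = CARD('n)"
  shows "card A \<le> CARD('n)"
proof -
  obtain \<beta> :: "'n \<Rightarrow> 'n derivation" where \<beta>: "bij_betw \<beta> UNIV B"
    using finite_same_card_bij[of "UNIV :: 'n set" B] assms by auto
  obtain \<mu> where \<mu>:
    "\<And>b H x. b \<in> B \<Longrightarrow> H \<in> A \<Longrightarrow> dot (normal H) (eval_deriv b x) = \<mu> b H * dot (normal H) x"
    using basis_eigenvalue by metis
  define m :: "(complex ^ 'n) set \<Rightarrow> complex ^ 'n" where "m H = (\<chi> i. \<mu> (\<beta> i) H)" for H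
  have indep: "c K = 0" if "(\<Sum>H\<in>A. c H *s m H) = 0" "K \<in> A" for c K
  proof (rule log_forms_independent[OF \<mu> _ that(2)])
    fix b assume "b \<in> B"
    then obtain i where "b = \<beta> i"
      using \<beta> by (auto simp: bij_betw_def)
    then show "(\<Sum>H\<in>A. c H * \<mu> b H) = 0"
      using arg_cong[OF that(1), of "\<lambda>w. w $ i"] by (simp add: m_def)
  qed
  \<comment> \<open>Needed separately, because a coincidence \<open>m H = m K\<close> is invisible
    in the image of \<open>A\<close>; it would be the relation with coefficients 1 and -1.\<close>
  have inj: "inj_on m A"
  proof (rule inj_onI, rule ccontr)
    fix H K assume HK: "H \<in> A" "K \<in> A" "m H = m K" "H \<noteq> K"
    define c :: "(complex ^ 'n) set \<Rightarrow> complex" where "c J = (if J = H then 1 else if J = K then - 1 else 0)" for J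
    have "(\<Sum>J\<in>A. c J *s m J) = (\<Sum>J\<in>{H, K}. c J *s m J)"
      using HK finite_A by (intro sum.mono_neutral_right) (auto simp: c_def)
    also have "\<dots> = 0"
      using HK by (simp add: c_def vec_eq_iff)
    finally have "c H = 0"
      using HK(1) by (rule indep)
    then show False by (simp add: c_def)
  qed
  have "vec.independent (m ` A)"
  proof
    assume "vec.dependent (m ` A)"
    then obtain u v where "v \<in> m ` A" "u v \<noteq> 0" "(\<Sum>v\<in>m ` A. u v *s v) = 0"
      using finite_A by (auto simp: vec.dependent_finite)
    then show False
      using indep[of "u \<circ> m"] by (auto simp: sum.reindex[OF inj])
  qed
  then have "card (m ` A) \<le> vec.dim (m ` A)"
    by (simp add: vec.dim_eq_card_independent)
  also have "\<dots> \<le> CARD('n)"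
    by (rule dim_subset_UNIV_cart_gen)
  finally show ?thesis
    by (simp add: card_image[OF inj])
qed

end

section \<open>Intersections of hyperplanes\<close>

lemma hyperplane_not_subset:
  fixes H K :: "(complex ^ ('n::finite)) set"
  assumes "linear_hyperplane H" "linear_hyperplane K" "H \<noteq> K"
  shows "\<exists>v\<in>H. v \<notin> K"
proof (rule ccontr)
  assume "\<not> (\<exists>v\<in>H. v \<notin> K)"
  then have "H = K"
    using assms(1,2) unfolding linear_hyperplane_def
    by (intro vec.subspace_dim_equal) auto
  then show False using assms(3) by simp
qed

text \<open>\<open>H\<close> is spanned by \<open>H \<inter> K\<close> and one vector
  \<open>w\<close> off \<open>K\<close>, so the dimension drops by exactly one.\<close>

lemma dim_hyperplane_Int:
  fixes H K :: "(complex ^ ('n::finite)) set"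
  assumes "linear_hyperplane H" "linear_hyperplane K" "H \<noteq> K"
    and form: "K = {x. dot a x = 0}"
  shows "vec.dim (H \<inter> K) + 2 = CARD('n)"
proof -
  have sub: "vec.subspace H" "vec.subspace K" "vec.subspace (H \<inter> K)"
    using assms by (auto simp: linear_hyperplane_def vec.subspace_inter)
  obtain w where w: "w \<in> H" "w \<notin> K"
    using hyperplane_not_subset[OF assms(1-3)] by blast
  have "H \<subseteq> vec.span (insert w (H \<inter> K))"
  proof
    fix x assume "x \<in> H"
    let ?c = "dot a x / dot a w"
    have "x - ?c *s w \<in> H \<inter> K"
      using w \<open>x \<in> H\<close> sub(1) by (auto simp: form intro!: vec.subspace_diff vec.subspace_scale)
    then show "x \<in> vec.span (insert w (H \<inter> K))"
      unfolding vec.span_insert by (auto intro: vec.span_base)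
  qed
  then have "vec.dim H \<le> vec.dim (insert w (H \<inter> K))"
    by (metis vec.dim_span vec.dim_subset)
  moreover have "vec.dim (insert w (H \<inter> K)) \<le> vec.dim (H \<inter> K) + 1"
    by (simp add: vec.dim_insert)
  moreover have "vec.dim (H \<inter> K) < vec.dim H"
  proof (rule ccontr)
    assume "\<not> vec.dim (H \<inter> K) < vec.dim H"
    then have "H \<inter> K = H"
      using sub by (intro vec.subspace_dim_equal) auto
    then show False using w by blast
  qed
  ultimately show ?thesis
    using assms(1) by (simp add: linear_hyperplane_def)
qed

lemma no_triple_line:
  fixes A :: "(complex ^ 4) set set"
  assumes A: "central_arrangement A"
    and triple: "\<forall>r>2. num_fold_lines A r = 0"
    and form: "\<And>H. H \<in> A \<Longrightarrow> \<exists>a. H = {x. dot a x = 0}"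
    and HKJ: "H \<in> A" "K \<in> A" "J \<in> A" "H \<noteq> K" "H \<noteq> J" "K \<noteq> J"
  shows "\<exists>v\<in>H \<inter> K. v \<notin> J"
proof (rule ccontr)
  assume "\<not> (\<exists>v\<in>H \<inter> K. v \<notin> J)"
  then have sub: "H \<inter> K \<subseteq> J" by blast
  have fin: "finite A" and hyp: "\<And>H. H \<in> A \<Longrightarrow> linear_hyperplane H"
    using A by (auto simp: central_arrangement_def)
  have Int: "vec.subspace (X \<inter> Y) \<and> vec.dim (X \<inter> Y) = 2"
    if XY: "X \<in> A" "Y \<in> A" "X \<noteq> Y" for X Y
  proof -
    obtain a where "Y = {x. dot a x = 0}"
      using form XY by blast
    from dim_hyperplane_Int[OF hyp hyp XY(3) this] show ?thesis
      using XY hyp by (auto simp: linear_hyperplane_def vec.subspace_inter)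
  qed
  \<comment> \<open>The true multiplicity of \<open>H \<inter> K\<close>, which may exceed
    3.\<close>
  define r where "r = card {X\<in>A. H \<inter> K \<subseteq> X}"
  let ?L = "{L. vec.subspace L \<and> vec.dim L = 2 \<and> card {X\<in>A. L \<subseteq> X} = r}"
  have "card {H, K, J} \<le> r"
    unfolding r_def using fin HKJ sub by (intro card_mono) auto
  then have r: "r > 2"
    using HKJ by simp
  \<comment> \<open>Finiteness matters: \<open>card\<close> of an infinite set is 0, and then
    \<open>num_fold_lines A r = 0\<close> would be no contradiction.\<close>
  have "?L \<subseteq> (\<lambda>(X, Y). X \<inter> Y) ` (A \<times> A)"
  proof
    fix L assume L: "L \<in> ?L"
    then have "\<not> card {X\<in>A. L \<subseteq> X} \<le> Suc 0"
      using r by simp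
    then obtain X Y where XY: "X \<in> A" "Y \<in> A" "L \<subseteq> X" "L \<subseteq> Y" "X \<noteq> Y"
      using fin by (auto simp: card_le_Suc0_iff_eq)
    then have "L = X \<inter> Y"
      using L Int[of X Y] by (intro vec.subspace_dim_equal) auto
    then show "L \<in> (\<lambda>(X, Y). X \<inter> Y) ` (A \<times> A)"
      using XY by auto
  qed
  then have "finite ?L"
    using fin by (meson finite_SigmaI finite_imageI finite_subset)
  moreover have "H \<inter> K \<in> ?L"
    using Int HKJ by (simp add: r_def)
  ultimately have "num_fold_lines A r > 0"
    unfolding num_fold_lines_def by (metis (no_types, lifting) card_gt_0_iff empty_iff)
  then show False using triple r by simp
qed

theorem proposition4p1:
  fixes A :: "(complex ^ 4) set set"
    and \<alpha> :: "(complex ^ 4) set \<Rightarrow> 4 cpoly"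
    and k :: nat
  assumes "central_arrangement A"
    and "essential A"
    and "card A = k"
    and "k \<ge> 4"
    and "num_fold_lines A 2 = k choose 2"
    and "\<forall>r>2. num_fold_lines A r = 0"
    and "defining_forms A \<alpha>"
    and "free_arrangement A \<alpha>"
  shows "k = 4"
proof -
  have hyp: "finite A" "\<And>H. H \<in> A \<Longrightarrow> linear_hyperplane H"
    using assms(1) by (auto simp: central_arrangement_def)
  have forms: "homogeneous_poly 1 (\<alpha> H)" "{x. poly_eval (\<alpha> H) x = 0} = H" if "H \<in> A" for H
    using assms(7) that by (auto simp: defining_forms_def)
  have form: "\<exists>a. H = {x. dot a x = 0}" if "H \<in> A" for H
    using forms[OF that] by (intro exI[of _ "form_vector (\<alpha> H)"]) (simp add: poly_eval_linear_form)
  obtain B where B: "finite B" "card B = CARD(4)" "\<forall>\<theta>\<in>B. \<exists>d. homogeneous_deriv d \<theta>"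
    "der.independent B" "der.span B = derivation_module A \<alpha>"
    using assms(8) by (auto simp: free_arrangement_def)
  interpret generic_free_arrangement A \<alpha> B
  proof
    show "\<exists>v. v \<notin> H" if "H \<in> A" for H
    proof (rule ccontr)
      assume "\<not> (\<exists>v. v \<notin> H)"
      then have "H = UNIV" by blast
      then show False
        using hyp(2)[OF that] vec_dim_card[where 'a = complex and 'n = 4]
        by (simp add: linear_hyperplane_def del: vec.dim_UNIV)
    qed
    show "\<exists>v\<in>H. v \<notin> K" if "H \<in> A" "K \<in> A" "H \<noteq> K" for H K
      using hyperplane_not_subset hyp(2) that by blast
    show "\<exists>v\<in>H \<inter> K. v \<notin> J"
      if "H \<in> A" "K \<in> A" "J \<in> A" "H \<noteq> K" "H \<noteq> J" "K \<noteq> J" for H K J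
      using no_triple_line[OF assms(1,6) form] that by blast
  qed (use hyp forms B in auto)
  show ?thesis
    using card_le[OF B(1,2)] assms(3,4) by simp
qed

end
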